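(* Let $q$ be an even positive integer, let $N\in\mathbb{N}$, and put $M:=\binom{N+q-1}{q}$. Let $(\Omega,\mu)$ be a measure space and let $X_N\subset L_q(\Omega,\mu)$ be an $N$-dimensional real linear subspace of real-valued functions on $\Omega$. Then there exist points $\xi^1,\dots,\xi^M\in\Omega$ and real numbers $\lambda_1,\dots,\lambda_M$ such that for every $f\in X_N$ $$\int_\Omega |f|^q\,d\mu=\sum_{\nu=1}^M \lambda_\nu |f(\xi^\nu)|^q .$$
   Context: Elements of $X_N$ are actual functions defined at every point of $\Omega$ (so that point values make sense), with $\int_\Omega|f|^q\,d\mu<\infty$. The weights $\lambda_\nu$ may be of any sign (or zero) and the nodes $\xi^\nu$ are not required to be distinct. In the paper's notation the conclusion is written $X_N\in\mathcal{M}^w(M,q,0)$. *)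

theory Defs
  imports "HOL-Analysis.Analysis" "HOL-Library.Function_Algebras"
begin

text \<open>
  Pointwise scalar multiplication, so that \<open>subspace\<close>, \<open>span\<close> and \<open>dim\<close> apply to sets of
  functions; the pointwise group structure is that of \<open>Function_Algebras\<close>.
\<close>

instantiation "fun" :: (type, real_vector) real_vector
begin

definition scaleR_fun :: "real \<Rightarrow> ('a \<Rightarrow> 'b) \<Rightarrow> 'a \<Rightarrow> 'b"
  where "scaleR_fun c f = (\<lambda>x. c *\<^sub>R f x)"

instance
  by standard (simp_all add: scaleR_fun_def fun_eq_iff scaleR_add_right scaleR_add_left)

end

text \<open>
  A real function on \<open>\<Omega> = space M\<close> is encoded by its extension by zero to the whole type; this
  makes equality and linear independence those of functions on \<open>\<Omega>\<close>. (\<open>extensional\<close> does not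
  serve, as it is not closed under addition.) Functions equal almost everywhere are not identified.
\<close>

definition Lq_functions :: "'a measure \<Rightarrow> nat \<Rightarrow> ('a \<Rightarrow> real) set"
  where "Lq_functions M q =
    {f \<in> borel_measurable M. (\<forall>x. x \<notin> space M \<longrightarrow> f x = 0) \<and> integrable M (\<lambda>x. \<bar>f x\<bar> ^ q)}"

text \<open>
  The spanning condition is needed because \<open>dim\<close> is also \<open>0\<close> on infinite-dimensional spaces.
\<close>

definition subspace_of_dim :: "'a::real_vector set \<Rightarrow> nat \<Rightarrow> bool"
  where "subspace_of_dim X N \<longleftrightarrow>
    subspace X \<and> (\<exists>B. finite B \<and> span B = X) \<and> dim X = N"

end

theory Submission
  imports Defs "HOL-Library.Multiset"
begin

text \<open>
  For even \<open>q\<close> the function \<open>\<bar>f\<bar> ^ q = f ^ q\<close> lies in the span of the products of \<open>q\<close> elements of a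
  basis of \<open>X\<close>, and there are at most \<open>(N + q - 1) choose q\<close> such products. A space of functions
  spanned by \<open>m\<close> functions admits an interpolation formula \<open>h = (\<Sum>t\<in>T. h t * g t)\<close> with at most
  \<open>m\<close> nodes and with cardinal functions \<open>g t\<close> from the space; integrating it gives the quadrature
  formula with weights \<open>\<integral> g t\<close>.
\<close>

lemma scaleR_fun_apply [simp]: "(c *\<^sub>R f) x = c *\<^sub>R f x"
  by (simp add: scaleR_fun_def)

lemma power_fun_apply [simp]: "(f ^ n) x = (f x ^ n :: 'b::monoid_mult)"
  by (induction n) simp_all

text \<open>Greedy choice of nodes, by induction on \<open>S\<close>: each new generator is compared
  with its interpolant at the nodes found so far, and any point where the two differ becomes one
  further node. So every generator costs at most one node.\<close>

lemma interpolation_on_span: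
  fixes S :: "('a \<Rightarrow> real) set"
  assumes "finite S" and "\<And>h x. h \<in> S \<Longrightarrow> x \<notin> A \<Longrightarrow> h x = 0"
  obtains T g where "finite T" "T \<subseteq> A" "card T \<le> card S"
    and "\<And>t. t \<in> T \<Longrightarrow> g t \<in> span S"
    and "\<And>h x. h \<in> span S \<Longrightarrow> h x = (\<Sum>t\<in>T. h t * g t x)"
proof -
  \<comment> \<open>The induction needs the biorthogonality of \<open>g\<close> at the nodes, which
    the conclusion drops, and the formula on the generators only.\<close>
  have "\<exists>T g. finite T \<and> T \<subseteq> A \<and> card T \<le> card S \<and> (\<forall>t\<in>T. g t \<in> span S) \<and>
      (\<forall>s\<in>T. \<forall>t\<in>T. g s t = (if s = t then 1 else 0)) \<and>
      (\<forall>h\<in>S. \<forall>x. h x = (\<Sum>t\<in>T. h t * g t x))"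
    using assms
  proof (induction S)
    case empty
    show ?case by (rule exI[of _ "{}"]) auto
  next
    case (insert b S)
    then obtain T g where T: "finite T" "T \<subseteq> A" "card T \<le> card S"
      and gS: "\<forall>t\<in>T. g t \<in> span S"
      and delta: "\<forall>s\<in>T. \<forall>t\<in>T. g s t = (if s = t then 1 else 0)"
      and rep: "\<forall>h\<in>S. \<forall>x. h x = (\<Sum>t\<in>T. h t * g t x)"
      by auto
    have gbS: "g t \<in> span (insert b S)" if "t \<in> T" for t
      using gS that span_mono[of S "insert b S"] by auto
    \<comment> \<open>The interpolation error of \<open>b\<close>; by biorthogonality it vanishes at
      all nodes in \<open>T\<close>.\<close>
    define r where "r = b - (\<Sum>t\<in>T. b t *\<^sub>R g t)"
    have r_apply: "r x = b x - (\<Sum>t\<in>T. b t * g t x)" for x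
    proof -
      have "(\<Sum>t\<in>T. b t *\<^sub>R g t) x = (\<Sum>t\<in>T. b t * g t x)"
        using T(1) by (induction T) auto
      then show ?thesis by (simp add: r_def)
    qed
    have r_span: "r \<in> span (insert b S)"
      unfolding r_def by (intro span_diff span_sum span_scale gbS) (auto intro: span_base)
    have rT: "r s = 0" if "s \<in> T" for s
    proof -
      have "(\<Sum>t\<in>T. b t * g t s) = (\<Sum>t\<in>T. if t = s then b t else 0)"
        using that delta by (intro sum.cong) auto
      then show ?thesis using that T(1) by (simp add: r_apply)
    qed
    show ?case
    proof (cases "\<exists>x. r x \<noteq> 0")
      case False
      then have "b x = (\<Sum>t\<in>T. b t * g t x)" for x
        using r_apply[of x] by simp
      then have "\<forall>h\<in>insert b S. \<forall>x. h x = (\<Sum>t\<in>T. h t * g t x)"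
        using rep by blast
      moreover have "card T \<le> card (insert b S)"
        using T(3) insert.hyps by simp
      ultimately show ?thesis using T(1,2) gbS delta by blast
    next
      case True
      then obtain y where y: "r y \<noteq> 0" by blast
      \<comment> \<open>Vanishing off \<open>A\<close> passes to the span, hence to
        \<open>r\<close>; this forces the new node \<open>y\<close> into \<open>A\<close>.\<close>
      have "h y = 0" if "y \<notin> A" "h \<in> span (insert b S)" for h
        using that(2) by (induction rule: span_induct_alt) (auto simp: insert.prems that(1))
      with r_span y have yA: "y \<in> A" by blast
      from rT y have yT: "y \<notin> T" by blast
      \<comment> \<open>The normalised error has value 1 at \<open>y\<close> and 0 on
        \<open>T\<close>, so it is the cardinal function of \<open>y\<close>. Subtracting
        \<open>g t y *\<^sub>R e\<close> makes an old cardinal function vanish at \<open>y\<close>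
        without changing it on \<open>T\<close>.\<close>
      define e where "e = (1 / r y) *\<^sub>R r"
      define g' where "g' t = (if t = y then e else g t - g t y *\<^sub>R e)" for t
      have e_span: "e \<in> span (insert b S)"
        unfolding e_def by (rule span_scale[OF r_span])
      have e_y: "e y = 1" and e_T: "\<And>t. t \<in> T \<Longrightarrow> e t = 0"
        using y rT by (auto simp: e_def)
      \<comment> \<open>The new interpolant is the old one plus the old error at \<open>y\<close>
        times \<open>e\<close>. This error is 0 for \<open>h\<close> in \<open>S\<close>, while for
        \<open>b\<close> the added term is \<open>r y * e x = r x\<close>, exactly what was
        missing.\<close>
      have sum_g': "(\<Sum>t\<in>insert y T. h t * g' t x) =
          (\<Sum>t\<in>T. h t * g t x) + (h y - (\<Sum>t\<in>T. h t * g t y)) * e x" for h x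
      proof -
        have "(\<Sum>t\<in>T. h t * g' t x) = (\<Sum>t\<in>T. h t * g t x - h t * g t y * e x)"
          using yT by (intro sum.cong) (auto simp: g'_def algebra_simps)
        also have "\<dots> = (\<Sum>t\<in>T. h t * g t x) - (\<Sum>t\<in>T. h t * g t y) * e x"
          by (simp add: sum_subtractf sum_distrib_right)
        finally show ?thesis
          using yT T(1) by (simp add: g'_def algebra_simps)
      qed
      have "b x = (\<Sum>t\<in>insert y T. b t * g' t x)" for x
      proof -
        have "r y * e x = r x" using y by (simp add: e_def)
        then show ?thesis unfolding sum_g' using r_apply[of x] r_apply[of y] by simp
      qed
      moreover have "h x = (\<Sum>t\<in>insert y T. h t * g' t x)" if "h \<in> S" for h x
      proof -
        have "h z = (\<Sum>t\<in>T. h t * g t z)" for z using rep that by blast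
        from this[of x] this[of y] show ?thesis unfolding sum_g' by simp
      qed
      moreover have "g' t \<in> span (insert b S)" if "t \<in> insert y T" for t
        using that gbS e_span by (auto simp: g'_def intro!: span_diff span_scale)
      moreover have "g' s t = (if s = t then 1 else 0)" if "s \<in> insert y T" "t \<in> insert y T" for s t
        using that delta yT e_y e_T by (auto simp: g'_def)
      moreover have "finite (insert y T)" "insert y T \<subseteq> A" "card (insert y T) \<le> card (insert b S)"
        using T yA yT insert.hyps by auto
      ultimately show ?thesis
        by (intro exI[of _ "insert y T"] exI[of _ g'] conjI ballI allI) (blast | force)+
    qed
  qed
  then obtain T g where T: "finite T" "T \<subseteq> A" "card T \<le> card S" "\<forall>t\<in>T. g t \<in> span S"
    and rep: "\<forall>h\<in>S. \<forall>x. h x = (\<Sum>t\<in>T. h t * g t x)" by blast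
  have "h x = (\<Sum>t\<in>T. h t * g t x)" if "h \<in> span S" for h x
    using that
  proof (induction arbitrary: x rule: span_induct_alt)
    case base
    show ?case by simp
  next
    case (step c u v)
    have u: "u x = (\<Sum>t\<in>T. u t * g t x)" using rep step.hyps by blast
    have "(\<Sum>t\<in>T. (c *\<^sub>R u + v) t * g t x) =
        c * (\<Sum>t\<in>T. u t * g t x) + (\<Sum>t\<in>T. v t * g t x)"
      by (simp add: distrib_right sum.distrib sum_distrib_left mult.assoc)
    then show ?case by (simp flip: u step.IH)
  qed
  with T that show thesis by blast
qed

text \<open>Expand the power by multilinearity. Multiplication is commutative, so a product depends
  only on the multiset of its factors; indexing by multisets rather than lists yields the required
  count.\<close>

lemma power_in_span_prod_mset:
  fixes f :: "'a \<Rightarrow> real"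
  assumes "f \<in> span B"
  shows "f ^ n \<in> span (prod_mset ` multisets_of_size B n)"
proof (induction n)
  case 0
  have "{#} \<in> multisets_of_size B 0" by (simp add: multisets_of_size_def)
  then have "1 \<in> prod_mset ` multisets_of_size B 0" by (metis image_eqI prod_mset_empty)
  then show ?case by (simp add: span_base)
next
  case (Suc n)
  let ?P = "\<lambda>k. span (prod_mset ` multisets_of_size B k)"
  have scale: "(c *\<^sub>R u + v) * w = c *\<^sub>R (u * w) + v * w" for c and u v w :: "'a \<Rightarrow> real"
    by (auto simp: fun_eq_iff algebra_simps)
  \<comment> \<open>Multiplication by one generator raises the degree by one. Linearity in
    \<open>p\<close> is used here, linearity in \<open>f\<close> in the induction after it.\<close>
  have basis: "b * p \<in> ?P (Suc n)" if "b \<in> B" "p \<in> ?P n" for b p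
    using that(2)
  proof (induction rule: span_induct_alt)
    case base
    show ?case by (simp only: mult_zero_left mult_zero_right span_zero)
  next
    case (step c u v)
    then obtain m where m: "m \<in> multisets_of_size B n" "u = prod_mset m" by blast
    have "add_mset b m \<in> multisets_of_size B (Suc n)"
      using m that(1) by (auto simp: multisets_of_size_def)
    moreover have "u * b = prod_mset (add_mset b m)" by (simp add: m mult.commute)
    ultimately have "u * b \<in> ?P (Suc n)" by (metis image_eqI span_base)
    then have "c *\<^sub>R (u * b) + v * b \<in> ?P (Suc n)"
      using step by (intro span_add span_scale) (simp_all add: times_fun_def mult.commute)
    then show ?case by (metis mult.commute scale)
  qed
  have "f * p \<in> ?P (Suc n)" if "p \<in> ?P n" for p
    using assms
  proof (induction rule: span_induct_alt)
    case base
    show ?case by (simp only: mult_zero_left mult_zero_right span_zero)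
  next
    case (step c u v)
    then show ?case
      unfolding scale using basis that by (intro span_add span_scale)
  qed
  then show ?case using Suc.IH by (simp only: power_Suc)
qed

text \<open>Instead of the Hoelder inequality, a pointwise bound: a product of \<open>size m\<close>
  factors is at most the largest absolute value to that power, hence at most the sum of all these
  powers. The empty product 1 is excluded, as it need not be integrable on a space of infinite
  measure.\<close>

lemma integrable_prod_mset:
  fixes M :: "'a measure" and m :: "('a \<Rightarrow> real) multiset"
  assumes "\<And>b. b \<in># m \<Longrightarrow> b \<in> borel_measurable M"
    and "\<And>b. b \<in># m \<Longrightarrow> integrable M (\<lambda>x. \<bar>b x\<bar> ^ size m)"
    and "m \<noteq> {#}"
  shows "integrable M (prod_mset m)"
proof (rule Bochner_Integration.integrable_bound)
  show "integrable M (\<lambda>x. \<Sum>b\<in>set_mset m. \<bar>b x\<bar> ^ size m)"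
    using assms(2) by (intro Bochner_Integration.integrable_sum) auto
  show "prod_mset m \<in> borel_measurable M"
    using assms(1)
  proof (induction m)
    case empty
    have "(1 :: 'a \<Rightarrow> real) = (\<lambda>_. 1)" by (simp add: fun_eq_iff)
    then show ?case by (metis borel_measurable_const prod_mset_empty)
  next
    case (add b m)
    have "prod_mset (add_mset b m) = (\<lambda>x. b x * prod_mset m x)" by (simp add: fun_eq_iff)
    then show ?case using add by simp
  qed
  show "AE x in M. norm (prod_mset m x) \<le> norm (\<Sum>b\<in>set_mset m. \<bar>b x\<bar> ^ size m)"
  proof (intro AE_I2)
    fix x
    define c where "c = Max ((\<lambda>b. \<bar>b x\<bar>) ` set_mset m)"
    have "c \<in> (\<lambda>b. \<bar>b x\<bar>) ` set_mset m"
      unfolding c_def using assms(3) by (intro Max_in) auto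
    then obtain b where b: "b \<in># m" "c = \<bar>b x\<bar>" by auto
    have le: "\<bar>a x\<bar> \<le> c" if "a \<in># m" for a
      unfolding c_def using that by (intro Max_ge) auto
    \<comment> \<open>Stated for submultisets, so that \<open>c\<close> stays the maximum over all
      of \<open>m\<close> during the induction.\<close>
    have "\<bar>prod_mset k x\<bar> \<le> c ^ size k" if "k \<subseteq># m" for k
      using that
    proof (induction k)
      case empty
      show ?case by simp
    next
      case (add a k)
      have "k \<subseteq># m" using add.prems by (meson mset_subset_eq_insertD subset_mset.less_imp_le)
      have "\<bar>a x\<bar> \<le> c" using add.prems by (intro le) (auto dest: mset_subset_eqD)
      moreover have "\<bar>prod_mset k x\<bar> \<le> c ^ size k"
        using add.IH \<open>k \<subseteq># m\<close> by blast
      ultimately show ?case by (auto simp: abs_mult intro!: mult_mono)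
    qed
    then have "\<bar>prod_mset m x\<bar> \<le> c ^ size m" by simp
    also have "\<dots> \<le> (\<Sum>b\<in>set_mset m. \<bar>b x\<bar> ^ size m)"
      unfolding b(2) using b(1) by (intro member_le_sum) auto
    finally show "norm (prod_mset m x) \<le> norm (\<Sum>b\<in>set_mset m. \<bar>b x\<bar> ^ size m)" by simp
  qed
qed

theorem theorem3p1:
  fixes \<mu> :: "'a measure" and q N :: nat and X :: "('a \<Rightarrow> real) set"
  assumes "even q" and "q > 0"
    and "X \<subseteq> Lq_functions \<mu> q"
    and "subspace_of_dim X N"
  shows "\<exists>(\<xi> :: nat \<Rightarrow> 'a) (w :: nat \<Rightarrow> real).
    (\<forall>\<nu>\<in>{1..(N + q - 1) choose q}. \<xi> \<nu> \<in> space \<mu>) \<and>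
    (\<forall>f\<in>X. (\<integral>x. \<bar>f x\<bar> ^ q \<partial>\<mu>) = (\<Sum>\<nu>=1..(N + q - 1) choose q. w \<nu> * \<bar>f (\<xi> \<nu>)\<bar> ^ q))"
proof -
  obtain C where X: "finite C" "span C = X" "dim X = N"
    using assms(4) by (auto simp: subspace_of_dim_def)
  obtain B where B: "B \<subseteq> X" "independent B" "X \<subseteq> span B" "card B = N"
    using basis_exists X(3) by metis
  have "finite B" using independent_span_bound[of C B] B X by auto
  let ?M = "(N + q - 1) choose q"
  define S where "S = prod_mset ` multisets_of_size B q"
  have finS: "finite S"
    unfolding S_def using \<open>finite B\<close> by (simp add: finite_multisets_of_size)
  \<comment> \<open>Only an inequality, since different multisets may have the same product.\<close>
  have cardS: "card S \<le> ?M"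
    unfolding S_def using card_image_le[of "multisets_of_size B q" prod_mset]
      \<open>finite B\<close> B(4) by (simp add: finite_multisets_of_size card_multisets_of_size)
  \<comment> \<open>Integrability will give the weights, and vanishing outside
    \<open>space \<mu>\<close> will keep the nodes inside it. Both use that a product has at least
    one factor, by \<open>q > 0\<close>.\<close>
  have mono: "integrable \<mu> h" "x \<notin> space \<mu> \<Longrightarrow> h x = 0" if "h \<in> S" for h x
  proof -
    obtain m where m: "set_mset m \<subseteq> B" "size m = q" "h = prod_mset m"
      using \<open>h \<in> S\<close> by (auto simp: S_def multisets_of_size_def)
    have Lq: "b \<in> Lq_functions \<mu> q" if "b \<in># m" for b
      using that m(1) B(1) assms(3) by auto
    have "m \<noteq> {#}" using m(2) assms(2) by auto
    then show "integrable \<mu> h"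
      unfolding m(3) using Lq by (intro integrable_prod_mset) (auto simp: Lq_functions_def m(2))
    obtain b k where "m = add_mset b k" using \<open>m \<noteq> {#}\<close> multiset_cases by blast
    then show "h x = 0" if "x \<notin> space \<mu>"
      using m(3) Lq[of b] that by (simp add: Lq_functions_def)
  qed
  obtain T g where T: "finite T" "T \<subseteq> space \<mu>" "card T \<le> card S"
    and g: "\<And>t. t \<in> T \<Longrightarrow> g t \<in> span S"
    and rep: "\<And>h x. h \<in> span S \<Longrightarrow> h x = (\<Sum>t\<in>T. h t * g t x)"
    by (rule interpolation_on_span[OF finS, of "space \<mu>"]) (use mono(2) in blast)+
  have int: "integrable \<mu> h" if "h \<in> span S" for h
    using that
  proof (induction rule: span_induct_alt)
    case base
    show ?case by (simp add: zero_fun_def)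
  next
    case (step c u v)
    then show ?case using mono(1) by (simp add: plus_fun_def)
  qed
  have quad: "(\<integral>x. \<bar>f x\<bar> ^ q \<partial>\<mu>) = (\<Sum>t\<in>T. integral\<^sup>L \<mu> (g t) * \<bar>f t\<bar> ^ q)" if "f \<in> X" for f
  proof -
    have fq: "f ^ q \<in> span S"
      unfolding S_def using that B(3) by (intro power_in_span_prod_mset) auto
    \<comment> \<open>Evenness of \<open>q\<close> enters here: it turns the integrand into a
      polynomial in the basis functions.\<close>
    have abs: "\<bar>f x\<bar> ^ q = (f ^ q) x" for x
      using assms(1) by (simp add: power_even_abs)
    have "(\<integral>x. \<bar>f x\<bar> ^ q \<partial>\<mu>) = (\<integral>x. (\<Sum>t\<in>T. \<bar>f t\<bar> ^ q * g t x) \<partial>\<mu>)"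
      unfolding abs by (intro Bochner_Integration.integral_cong refl rep[OF fq])
    also have "\<dots> = (\<Sum>t\<in>T. \<bar>f t\<bar> ^ q * integral\<^sup>L \<mu> (g t))"
      using int g by simp
    finally show ?thesis by (simp only: mult.commute)
  qed
  obtain \<xi>0 where \<xi>0: "bij_betw \<xi>0 {1..card T} T"
    using ex_bij_betw_nat_finite_1[OF T(1)] by blast
  \<comment> \<open>A point for padding the list of nodes. If the space is empty, then
    \<open>X\<close> contains only 0, so \<open>N = 0\<close> and the binomial coefficient
    \<open>(q - 1) choose q\<close> is 0: no node is asked for.\<close>
  obtain p where p: "?M \<noteq> 0 \<Longrightarrow> p \<in> space \<mu>"
  proof (cases "space \<mu> = {}")
    case True
    then have "f = 0" if "f \<in> X" for f
      using that assms(3) by (auto simp: Lq_functions_def fun_eq_iff)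
    then have "B \<subseteq> {0}" using B(1) by auto
    then have "B = {}" using B(2) dependent_zero by blast
    then have "N = 0" using B(4) by simp
    then show ?thesis using assms(2) that by simp
  qed (use that in blast)
  \<comment> \<open>There may be fewer than \<open>?M\<close> nodes in \<open>T\<close>; the
    remaining places repeat \<open>p\<close> with weight 0.\<close>
  define \<xi> where "\<xi> \<nu> = (if \<nu> \<le> card T then \<xi>0 \<nu> else p)" for \<nu>
  define w where "w \<nu> = (if \<nu> \<le> card T then integral\<^sup>L \<mu> (g (\<xi>0 \<nu>)) else 0)" for \<nu>
  have "\<xi> \<nu> \<in> space \<mu>" if "\<nu> \<in> {1..?M}" for \<nu>
  proof (cases "\<nu> \<le> card T")
    case True
    then show ?thesis
      using that T(2) bij_betwE[OF \<xi>0] by (auto simp: \<xi>_def)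
  next
    case False
    from that have "?M \<noteq> 0" by (simp del: binomial_eq_0_iff)
    then have "p \<in> space \<mu>" by (rule p)
    with False show ?thesis by (simp add: \<xi>_def)
  qed
  moreover have "(\<integral>x. \<bar>f x\<bar> ^ q \<partial>\<mu>) = (\<Sum>\<nu>=1..?M. w \<nu> * \<bar>f (\<xi> \<nu>)\<bar> ^ q)" if "f \<in> X" for f
  proof -
    have "(\<integral>x. \<bar>f x\<bar> ^ q \<partial>\<mu>) = (\<Sum>\<nu>=1..card T. integral\<^sup>L \<mu> (g (\<xi>0 \<nu>)) * \<bar>f (\<xi>0 \<nu>)\<bar> ^ q)"
      unfolding quad[OF that] by (rule sum.reindex_bij_betw[OF \<xi>0, symmetric])
    also have "\<dots> = (\<Sum>\<nu>=1..card T. w \<nu> * \<bar>f (\<xi> \<nu>)\<bar> ^ q)"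
      by (intro sum.cong) (auto simp: w_def \<xi>_def)
    also have "\<dots> = (\<Sum>\<nu>=1..?M. w \<nu> * \<bar>f (\<xi> \<nu>)\<bar> ^ q)"
      using T(3) cardS by (intro sum.mono_neutral_left) (auto simp: w_def)
    finally show ?thesis .
  qed
  ultimately show ?thesis by blast
qed

end
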